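(* Let $\mathscr{H}$ be a nonzero complex Hilbert space and let $T_1, T_2\in \mathbb{B}(\mathscr{H})$. Then the following statements are equivalent: (i) $T_1\parallel T_2$; (ii) there exist a sequence of unit vectors $\{\xi_n\}$ in $\mathscr{H}$ and $\lambda\in\mathbb{T}$ such that $\lim_{n\rightarrow\infty} (T_1\xi_n\mid T_2\xi_n)=\lambda\|T_1\|\,\|T_2\|$; (iii) $r(T_2^* T_1)=\|T_2^* T_1\|=\|T_1\|\,\|T_2\|$; (iv) $T_1^* T_1\parallel T_1^* T_2$ and $\|T_1^* T_2\|=\|T_1\|\,\|T_2\|$; (v) $\|T_1^*(T_1+\lambda T_2)\|=\|T_1\|(\|T_1\|+\|T_2\|)$ for some $\lambda\in\mathbb{T}$.
   Context: $\mathbb{B}(\mathscr{H})$ is the $C^*$-algebra of bounded linear operators on $\mathscr{H}$ with the operator norm; $(\cdot\mid\cdot)$ is the inner product of $\mathscr{H}$, linear in the first variable; $r(T)$ is the spectral radius of $T$; $\mathbb{T}=\{\alpha\in\mathbb{C}:|\alpha|=1\}$. For elements $x,y$ of a normed space, $x\parallel y$ ($x$ is parallel to $y$) means that $\|x+\lambda y\|=\|x\|+\|y\|$ for some $\lambda\in\mathbb{T}$; here this is used in $\mathbb{B}(\mathscr{H})$ with the operator norm. *)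

theory Defs
  imports "HOL-Analysis.Analysis"
begin

section \<open>Complex Hilbert spaces\<close>

class complex_vector = real_vector +
  fixes scaleC :: "complex \<Rightarrow> 'a \<Rightarrow> 'a"  (infixr \<open>*\<^sub>C\<close> 75)
  assumes scaleC_add_right: "a *\<^sub>C (x + y) = a *\<^sub>C x + a *\<^sub>C y"
    and scaleC_add_left: "(a + b) *\<^sub>C x = a *\<^sub>C x + b *\<^sub>C x"
    and scaleC_scaleC: "a *\<^sub>C (b *\<^sub>C x) = (a * b) *\<^sub>C x"
    and scaleC_one: "1 *\<^sub>C x = x"
    and scaleR_scaleC: "r *\<^sub>R x = complex_of_real r *\<^sub>C x"

class complex_normed_vector = complex_vector + real_normed_vector +
  assumes norm_scaleC: "norm (a *\<^sub>C x) = cmod a * norm x"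

text \<open>
  The inner product is linear in its first argument.  It is positive definite because
  the norm it induces is that of a normed space (see the two lemmas below).
\<close>

class complex_inner = complex_normed_vector +
  fixes cinner :: "'a \<Rightarrow> 'a \<Rightarrow> complex"
  assumes cinner_commute: "cinner x y = cnj (cinner y x)"
    and cinner_add_left: "cinner (x + y) z = cinner x z + cinner y z"
    and cinner_scaleC_left: "cinner (a *\<^sub>C x) y = a * cinner x y"
    and norm_eq_sqrt_cinner: "norm x = sqrt (Re (cinner x x))"

lemma cinner_self: "cinner x x = complex_of_real ((norm (x :: 'a :: complex_inner))\<^sup>2)"
proof -
  have "0 \<le> Re (cinner x x)"
    using norm_ge_zero[of x] unfolding norm_eq_sqrt_cinner by simp
  moreover have "Im (cinner x x) = 0"
    using arg_cong[OF cinner_commute[of x x], of Im] by simp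
  ultimately show ?thesis
    by (simp add: complex_eq_iff norm_eq_sqrt_cinner)
qed

lemma cinner_eq_zero_iff: "cinner x x = 0 \<longleftrightarrow> (x :: 'a :: complex_inner) = 0"
  by (simp add: cinner_self)

class complex_hilbert = complex_inner + complete_space


section \<open>Parallelism in a complex normed space\<close>

definition parallel :: "'a :: complex_normed_vector \<Rightarrow> 'a \<Rightarrow> bool"  (infix \<open>\<parallel>\<close> 50) where
  "x \<parallel> y \<longleftrightarrow> (\<exists>c :: complex. cmod c = 1 \<and> norm (x + c *\<^sub>C y) = norm x + norm y)"


section \<open>Bounded complex-linear operators\<close>

lemma scaleC_zero_right: "a *\<^sub>C (0 :: 'a :: complex_vector) = 0"
  using scaleC_add_right[of a "0 :: 'a" 0] by simp

lemma scaleC_minus_right: "a *\<^sub>C (- x) = - (a *\<^sub>C (x :: 'a :: complex_vector))"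
  using scaleC_add_right[of a x "- x"] by (simp add: scaleC_zero_right eq_neg_iff_add_eq_0 add.commute)

lemma scaleC_diff_right: "a *\<^sub>C (x - y) = a *\<^sub>C x - a *\<^sub>C (y :: 'a :: complex_vector)"
  using scaleC_add_right[of a x "- y"] by (simp add: scaleC_minus_right)

lemma scaleC_scaleR: "a *\<^sub>C (r *\<^sub>R x) = r *\<^sub>R (a *\<^sub>C (x :: 'a :: complex_vector))"
  by (simp add: scaleR_scaleC scaleC_scaleC mult.commute)

lemma bounded_linear_scaleC: "bounded_linear (\<lambda>x :: 'a :: complex_normed_vector. a *\<^sub>C x)"
  by (rule bounded_linear_intro[where K = "cmod a"])
    (simp_all add: scaleC_add_right scaleC_scaleR norm_scaleC)

lift_definition blinfun_scaleC_left :: "complex \<Rightarrow> 'a \<Rightarrow>\<^sub>L 'a :: complex_normed_vector"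
  is scaleC
  by (rule bounded_linear_scaleC)

declare blinfun_scaleC_left.rep_eq [simp]

lemma norm_blinfun_scaleC_left_compose:
  "norm (blinfun_scaleC_left a o\<^sub>L T) = cmod a * norm T"
proof -
  have le: "norm (blinfun_scaleC_left b o\<^sub>L S) \<le> cmod b * norm S"
    for b and S :: "'a \<Rightarrow>\<^sub>L 'b"
  proof (rule norm_blinfun_bound)
    fix x
    have "cmod b * norm (blinfun_apply S x) \<le> cmod b * (norm S * norm x)"
      by (intro mult_left_mono norm_blinfun) simp
    then show "norm (blinfun_apply (blinfun_scaleC_left b o\<^sub>L S) x) \<le> cmod b * norm S * norm x"
      by (simp add: norm_scaleC mult.assoc)
  qed simp
  show ?thesis
  proof (cases "a = 0")
    case True
    then show ?thesis
      using le[of a T] by simp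
  next
    case False
    have "blinfun_scaleC_left (inverse a) o\<^sub>L (blinfun_scaleC_left a o\<^sub>L T) = T"
      using False by (auto intro!: blinfun_eqI simp: scaleC_scaleC scaleC_one)
    with le[of "inverse a" "blinfun_scaleC_left a o\<^sub>L T"]
    have "norm T \<le> inverse (cmod a) * norm (blinfun_scaleC_left a o\<^sub>L T)"
      by (simp add: norm_inverse)
    with False have "cmod a * norm T \<le> norm (blinfun_scaleC_left a o\<^sub>L T)"
      by (simp add: field_simps)
    with le[of a T] show ?thesis
      by simp
  qed
qed

typedef (overloaded) ('a, 'b) cblinfun  (\<open>(_ \<Rightarrow>\<^sub>C\<^sub>L /_)\<close> [22, 21] 21) =
  "{T :: 'a :: complex_normed_vector \<Rightarrow>\<^sub>L 'b :: complex_normed_vector.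
      \<forall>a x. blinfun_apply T (a *\<^sub>C x) = a *\<^sub>C blinfun_apply T x}"
  by (rule exI[of _ 0]) (simp add: scaleC_zero_right)

setup_lifting type_definition_cblinfun

lift_definition cblinfun_apply ::
    "('a :: complex_normed_vector \<Rightarrow>\<^sub>C\<^sub>L 'b :: complex_normed_vector) \<Rightarrow> 'a \<Rightarrow> 'b"  (infixr \<open>*\<^sub>V\<close> 75)
  is blinfun_apply .

instantiation cblinfun :: (complex_normed_vector, complex_normed_vector) complex_normed_vector
begin

lift_definition zero_cblinfun :: "'a \<Rightarrow>\<^sub>C\<^sub>L 'b" is 0
  by (simp add: scaleC_zero_right)

lift_definition plus_cblinfun :: "'a \<Rightarrow>\<^sub>C\<^sub>L 'b \<Rightarrow> 'a \<Rightarrow>\<^sub>C\<^sub>L 'b \<Rightarrow> 'a \<Rightarrow>\<^sub>C\<^sub>L 'b" is "(+)"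
  by (simp add: blinfun.add_left scaleC_add_right)

lift_definition minus_cblinfun :: "'a \<Rightarrow>\<^sub>C\<^sub>L 'b \<Rightarrow> 'a \<Rightarrow>\<^sub>C\<^sub>L 'b \<Rightarrow> 'a \<Rightarrow>\<^sub>C\<^sub>L 'b" is "(-)"
  by (simp add: blinfun.diff_left scaleC_diff_right)

lift_definition uminus_cblinfun :: "'a \<Rightarrow>\<^sub>C\<^sub>L 'b \<Rightarrow> 'a \<Rightarrow>\<^sub>C\<^sub>L 'b" is uminus
  by (simp add: blinfun.minus_left scaleC_minus_right)

lift_definition scaleR_cblinfun :: "real \<Rightarrow> 'a \<Rightarrow>\<^sub>C\<^sub>L 'b \<Rightarrow> 'a \<Rightarrow>\<^sub>C\<^sub>L 'b" is "(*\<^sub>R)"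
  by (simp add: blinfun.scaleR_left scaleC_scaleR)

lift_definition scaleC_cblinfun :: "complex \<Rightarrow> 'a \<Rightarrow>\<^sub>C\<^sub>L 'b \<Rightarrow> 'a \<Rightarrow>\<^sub>C\<^sub>L 'b"
  is "\<lambda>a T. blinfun_scaleC_left a o\<^sub>L T"
  by (simp add: scaleC_scaleC mult.commute)

lift_definition norm_cblinfun :: "'a \<Rightarrow>\<^sub>C\<^sub>L 'b \<Rightarrow> real" is norm .

definition sgn_cblinfun :: "'a \<Rightarrow>\<^sub>C\<^sub>L 'b \<Rightarrow> 'a \<Rightarrow>\<^sub>C\<^sub>L 'b" where
  "sgn_cblinfun T = scaleR (inverse (norm T)) T"

definition dist_cblinfun :: "'a \<Rightarrow>\<^sub>C\<^sub>L 'b \<Rightarrow> 'a \<Rightarrow>\<^sub>C\<^sub>L 'b \<Rightarrow> real" where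
  "dist_cblinfun S T = norm (S - T)"

definition uniformity_cblinfun :: "(('a \<Rightarrow>\<^sub>C\<^sub>L 'b) \<times> ('a \<Rightarrow>\<^sub>C\<^sub>L 'b)) filter" where
  "uniformity_cblinfun = (INF e\<in>{0<..}. principal {(S, T). dist S T < e})"

definition open_cblinfun :: "('a \<Rightarrow>\<^sub>C\<^sub>L 'b) set \<Rightarrow> bool" where
  "open_cblinfun U \<longleftrightarrow> (\<forall>S\<in>U. \<forall>\<^sub>F (S', T) in uniformity. S' = S \<longrightarrow> T \<in> U)"

instance
proof
  fix S T U :: "'a \<Rightarrow>\<^sub>C\<^sub>L 'b" and a b :: complex and r s :: real
  show "S + T + U = S + (T + U)" by transfer simp
  show "S + T = T + S" by transfer simp
  show "0 + T = T" by transfer simp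
  show "- T + T = 0" by transfer simp
  show "S - T = S + - T" by transfer simp
  show "r *\<^sub>R (S + T) = r *\<^sub>R S + r *\<^sub>R T" by transfer (simp add: scaleR_add_right)
  show "(r + s) *\<^sub>R T = r *\<^sub>R T + s *\<^sub>R T" by transfer (simp add: scaleR_add_left)
  show "r *\<^sub>R (s *\<^sub>R T) = (r * s) *\<^sub>R T" by transfer simp
  show "1 *\<^sub>R T = T" by transfer simp
  show "a *\<^sub>C (S + T) = a *\<^sub>C S + a *\<^sub>C T"
    by transfer (auto intro!: blinfun_eqI simp: blinfun.add_left scaleC_add_right)
  show "(a + b) *\<^sub>C T = a *\<^sub>C T + b *\<^sub>C T"
    by transfer (auto intro!: blinfun_eqI simp: blinfun.add_left scaleC_add_left)
  show "a *\<^sub>C (b *\<^sub>C T) = (a * b) *\<^sub>C T"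
    by transfer (auto intro!: blinfun_eqI simp: scaleC_scaleC)
  show "1 *\<^sub>C T = T"
    by transfer (auto intro!: blinfun_eqI simp: scaleC_one)
  show "r *\<^sub>R T = complex_of_real r *\<^sub>C T"
    by transfer (auto intro!: blinfun_eqI simp: blinfun.scaleR_left scaleR_scaleC)
  show "dist S T = norm (S - T)" by (rule dist_cblinfun_def)
  show "sgn T = scaleR (inverse (norm T)) T" by (rule sgn_cblinfun_def)
  show "uniformity = (INF e\<in>{0<..}. principal {(S :: 'a \<Rightarrow>\<^sub>C\<^sub>L 'b, T). dist S T < e})"
    by (rule uniformity_cblinfun_def)
  show "open A \<longleftrightarrow> (\<forall>S\<in>A. \<forall>\<^sub>F (S', T) in uniformity. S' = S \<longrightarrow> T \<in> A)"
    for A :: "('a \<Rightarrow>\<^sub>C\<^sub>L 'b) set"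
    by (rule open_cblinfun_def)
  show "norm T = 0 \<longleftrightarrow> T = 0" by transfer simp
  show "norm (S + T) \<le> norm S + norm T" by transfer (rule norm_triangle_ineq)
  show "norm (r *\<^sub>R T) = \<bar>r\<bar> * norm T" by transfer simp
  show "norm (a *\<^sub>C T) = cmod a * norm T" by transfer (rule norm_blinfun_scaleC_left_compose)
qed

end

lift_definition cblinfun_id :: "'a \<Rightarrow>\<^sub>C\<^sub>L 'a :: complex_normed_vector" is id_blinfun
  by simp

lift_definition cblinfun_compose ::
    "('b :: complex_normed_vector \<Rightarrow>\<^sub>C\<^sub>L 'c :: complex_normed_vector)
      \<Rightarrow> ('a :: complex_normed_vector \<Rightarrow>\<^sub>C\<^sub>L 'b) \<Rightarrow> 'a \<Rightarrow>\<^sub>C\<^sub>L 'c"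
    (infixl \<open>o\<^sub>C\<^sub>L\<close> 70)
  is blinfun_compose
  by simp

lemma norm_cblinfun_eq_onorm: "norm T = onorm (cblinfun_apply T)"
  by transfer (rule norm_blinfun.rep_eq)

lemma cblinfun_apply_simps [simp]:
  "(S + T) *\<^sub>V x = S *\<^sub>V x + T *\<^sub>V x"
  "(S - T) *\<^sub>V x = S *\<^sub>V x - T *\<^sub>V x"
  "(a *\<^sub>C T) *\<^sub>V x = a *\<^sub>C (T *\<^sub>V x)"
  "cblinfun_id *\<^sub>V x = x"
  by (transfer, simp add: blinfun.add_left blinfun.diff_left)+

lemma cblinfun_compose_apply [simp]: "(R o\<^sub>C\<^sub>L S) *\<^sub>V x = R *\<^sub>V S *\<^sub>V x"
  by transfer simp

text \<open>
  The element described below is unique because the inner product is definite, and it exists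
  by the Riesz representation theorem, both spaces being complete.
\<close>

definition adj ::
    "('a :: complex_hilbert \<Rightarrow>\<^sub>C\<^sub>L 'b :: complex_hilbert) \<Rightarrow> 'b \<Rightarrow>\<^sub>C\<^sub>L 'a" where
  "adj T = (THE S. \<forall>x y. cinner (T *\<^sub>V x) y = cinner x (S *\<^sub>V y))"

text \<open>
  Invertibility is meant in the algebra of bounded complex-linear operators.  On a nonzero
  Banach space the spectrum is nonempty and contained in the closed disc of radius
  \<^term>\<open>norm T\<close>, so the supremum in the spectral radius is a genuine one there.
\<close>

definition spectrum :: "('a :: complex_normed_vector \<Rightarrow>\<^sub>C\<^sub>L 'a) \<Rightarrow> complex set" where
  "spectrum T = {z. \<not> (\<exists>S. S o\<^sub>C\<^sub>L (T - z *\<^sub>C cblinfun_id) = cblinfun_id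
                       \<and> (T - z *\<^sub>C cblinfun_id) o\<^sub>C\<^sub>L S = cblinfun_id)}"

definition spectral_radius :: "('a :: complex_normed_vector \<Rightarrow>\<^sub>C\<^sub>L 'a) \<Rightarrow> real" where
  "spectral_radius T = (SUP z\<in>spectrum T. cmod z)"

end

theory Submission
  imports Defs "HOL-Complex_Analysis.Cauchy_Integral_Formula"
begin

text \<open>
  Write \<open>|x|\<close> for the norm of a vector or an operator, \<open>a = |T1|\<close> and \<open>b = |T2|\<close>.  Since \<open>|T1 \<xi> + c T2 \<xi>|\<^sup>2\<close> is
  \<open>|T1 \<xi>|\<^sup>2 + |T2 \<xi>|\<^sup>2 + 2 Re (cnj c (T1 \<xi> | T2 \<xi>))\<close>, unit vectors at which \<open>T1 + c T2\<close> almost attains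
  the norm \<open>a + b\<close> are unit vectors at which \<open>(T1 \<xi> | T2 \<xi>)\<close> almost equals \<open>c a b\<close>.  This identifies
  parallelism with the existence of a sequence of inner products converging to a number of modulus
  \<open>a b\<close> (\<open>parallel_iff_cinner_limit\<close>).

  Moving \<open>T2\<close> across the inner product, such a sequence says that the numerical range of
  \<open>A = T2\<^sup>* T1\<close> comes arbitrarily close to a number of modulus \<open>a b\<close>, the largest value that the norm
  of \<open>A\<close> can have.  By the equality case of the Cauchy-Schwarz inequality this number is then an
  approximate eigenvalue, so the spectral radius, the norm of \<open>A\<close> and \<open>a b\<close> coincide.  For the
  converse, the spectrum lies in the closure of the numerical range
  (\<open>spectrum_subset_closure_numerical_range\<close>), and it contains values of modulus close to the spectral
  radius because it is not empty (\<open>spectrum_nonempty\<close>).  The two directions together are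
  \<open>numerical_range_limit_iff_spectral_radius\<close>.

  The conditions on \<open>T1\<^sup>* (T1 + c T2)\<close> follow from the C*-identity for \<open>T1 + c T2\<close> and the triangle
  inequality: each is a chain of upper bounds that can only be attained if every link is an equality
  (\<open>parallel_iff_norm_adj_compose\<close>, \<open>norm_adj_compose_iff_parallel\<close>).

  Adjoints exist by the Riesz representation theorem, which rests on the orthogonal vector supplied by
  \<open>closed_subspace_orthogonal_vector\<close>.  The same vector shows that an operator which is bounded
  below and has no vector orthogonal to its range is invertible.
\<close>


section \<open>Geometry of complex inner product spaces\<close>

lemma cinner_add_right: "cinner x (y + z) = cinner x y + cinner x (z :: 'a :: complex_inner)"
  by (subst (1 2 3) cinner_commute) (simp add: cinner_add_left)

lemma cinner_scaleC_right: "cinner x (a *\<^sub>C y) = cnj a * cinner x (y :: 'a :: complex_inner)"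
  by (subst (1 2) cinner_commute) (simp add: cinner_scaleC_left)

lemma cinner_diff_left: "cinner (x - y) z = cinner x z - cinner y (z :: 'a :: complex_inner)"
  using cinner_add_left[of "x - y" y z] by simp

lemma cinner_diff_right: "cinner x (y - z) = cinner x y - cinner x (z :: 'a :: complex_inner)"
  using cinner_add_right[of x "y - z" z] by simp

lemma cinner_zero_left [simp]: "cinner 0 (x :: 'a :: complex_inner) = 0"
  using cinner_diff_left[of x x x] by simp

lemma cinner_zero_right [simp]: "cinner x (0 :: 'a :: complex_inner) = 0"
  using cinner_diff_right[of x x x] by simp

lemmas cinner_simps =
  cinner_add_left cinner_add_right cinner_diff_left cinner_diff_right
  cinner_scaleC_left cinner_scaleC_right

lemma cinner_extensionality:
  assumes "\<And>x. cinner x y = cinner x (z :: 'a :: complex_inner)"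
  shows "y = z"
  using assms[of "y - z"] cinner_eq_zero_iff[of "y - z"] by (simp add: cinner_diff_right)

lemma norm_add_squared:
  "(norm (x + y))\<^sup>2 = (norm x)\<^sup>2 + (norm y)\<^sup>2 + 2 * Re (cinner x (y :: 'a :: complex_inner))"
proof -
  have "complex_of_real ((norm (x + y))\<^sup>2) = cinner (x + y) (x + y)"
    by (rule cinner_self[symmetric])
  also have "\<dots> = cinner x x + cinner y y + (cinner x y + cnj (cinner x y))"
    by (simp add: cinner_simps cinner_commute[of y x])
  finally have "Re (complex_of_real ((norm (x + y))\<^sup>2))
      = Re (cinner x x + cinner y y + (cinner x y + cnj (cinner x y)))"
    by (rule arg_cong)
  then show ?thesis by (simp add: cinner_self del: of_real_power)
qed

lemma norm_diff_squared:
  "(norm (x - y))\<^sup>2 = (norm x)\<^sup>2 + (norm y)\<^sup>2 - 2 * Re (cinner x (y :: 'a :: complex_inner))"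
  using norm_add_squared[of "x - y" y] by (simp add: cinner_diff_left cinner_self)

lemma parallelogram_law:
  "(norm (x + y))\<^sup>2 + (norm (x - y))\<^sup>2 = 2 * (norm x)\<^sup>2 + 2 * (norm (y :: 'a :: complex_inner))\<^sup>2"
  by (simp add: norm_add_squared norm_diff_squared)

text \<open>
  The vector subtracted from \<open>x\<close> is the orthogonal projection of \<open>x\<close> onto the line through \<open>y\<close>.
  Both the Cauchy-Schwarz inequality and the orthogonality of a shortest vector come from here.
\<close>

lemma norm_diff_projection_squared:
  fixes x y :: "'a :: complex_inner"
  assumes "y \<noteq> 0"
  shows "(norm (x - (cinner x y / (norm y)\<^sup>2) *\<^sub>C y))\<^sup>2 = (norm x)\<^sup>2 - (cmod (cinner x y))\<^sup>2 / (norm y)\<^sup>2"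
proof -
  let ?t = "cinner x y / (norm y)\<^sup>2"
  have "Re (cinner x (?t *\<^sub>C y)) = (cmod (cinner x y))\<^sup>2 / (norm y)\<^sup>2"
    by (simp add: cinner_scaleC_right mult.commute[of "cnj _"] complex_mult_cnj cmod_power2
        flip: of_real_power)
  moreover have "(norm (?t *\<^sub>C y))\<^sup>2 = (cmod (cinner x y))\<^sup>2 / (norm y)\<^sup>2"
    using assms by (simp add: norm_scaleC norm_divide norm_power power_mult_distrib power_divide)
      (simp add: power2_eq_square power4_eq_xxxx)
  ultimately show ?thesis by (simp add: norm_diff_squared)
qed

lemma complex_Cauchy_Schwarz: "cmod (cinner x y) \<le> norm x * norm (y :: 'a :: complex_inner)"
proof (cases "y = 0")
  case False
  then have "(cmod (cinner x y))\<^sup>2 / (norm y)\<^sup>2 \<le> (norm x)\<^sup>2"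
    using norm_diff_projection_squared[OF False, of x]
      zero_le_power2[of "norm (x - (cinner x y / (norm y)\<^sup>2) *\<^sub>C y)"] by linarith
  then have "(cmod (cinner x y))\<^sup>2 \<le> (norm x * norm y)\<^sup>2"
    using False by (simp add: divide_le_eq power_mult_distrib)
  then show ?thesis
    by (rule power2_le_imp_le) simp
qed simp

lemma bounded_linear_cinner_left: "bounded_linear (\<lambda>x. cinner x (y :: 'a :: complex_inner))"
  by (rule bounded_linear_intro[where K = "norm y"])
    (simp_all add: cinner_add_left scaleR_scaleC cinner_scaleC_left scaleR_conv_of_real
      complex_Cauchy_Schwarz)

text \<open>
  A shortest vector of \<open>y + M\<close> is orthogonal to \<open>M\<close>; it exists because a minimising sequence
  is Cauchy by the parallelogram law.
\<close>

lemma closed_subspace_orthogonal_vector: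
  fixes M :: "'a :: complex_hilbert set"
  assumes closed: "closed M" and zero: "0 \<in> M"
    and add: "\<And>u v. u \<in> M \<Longrightarrow> v \<in> M \<Longrightarrow> u + v \<in> M"
    and scale: "\<And>a u. u \<in> M \<Longrightarrow> a *\<^sub>C u \<in> M"
    and y: "y \<notin> M"
  obtains w where "w \<noteq> 0" "\<And>u. u \<in> M \<Longrightarrow> cinner w u = 0"
proof -
  define d where "d = (INF m\<in>M. norm (y - m))"
  have d_le: "d \<le> norm (y - m)" if "m \<in> M" for m
    unfolding d_def using that by (intro cINF_lower bdd_belowI2[where m = 0]) auto
  have d_nonneg: "0 \<le> d"
    unfolding d_def using zero by (intro cINF_greatest) auto
  have "\<exists>m\<in>M. norm (y - m) < d + 1 / Suc n" for n
  proof -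
    have "(INF m\<in>M. norm (y - m)) < d + 1 / Suc n"
      unfolding d_def[symmetric] by simp
    then show ?thesis
      using zero by (subst (asm) cINF_less_iff) (auto intro: bdd_belowI2[where m = 0])
  qed
  then obtain m where m: "\<And>n. m n \<in> M" and m_lt: "\<And>n. norm (y - m n) < d + 1 / Suc n"
    by metis
  have lim_d: "(\<lambda>n. norm (y - m n)) \<longlonglongrightarrow> d"
  proof (rule tendsto_sandwich[of "\<lambda>_. d" _ _ "\<lambda>n. d + 1 / Suc n"])
    show "\<forall>\<^sub>F n in sequentially. d \<le> norm (y - m n)" using d_le m by simp
    show "\<forall>\<^sub>F n in sequentially. norm (y - m n) \<le> d + 1 / Suc n" 
      using m_lt by (simp add: less_imp_le)
    show "(\<lambda>n. d + 1 / real (Suc n)) \<longlonglongrightarrow> d"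
      using tendsto_add[OF tendsto_const LIMSEQ_inverse_real_of_nat, of d]
      by (simp add: inverse_eq_divide)
  qed simp
  \<comment> \<open>The midpoint of two points of \<open>M\<close> lies in \<open>M\<close>, so it has distance at least \<open>d\<close> to \<open>y\<close>.\<close>
  have close: "(norm (m k - m l))\<^sup>2 \<le> 2 * (norm (y - m k))\<^sup>2 + 2 * (norm (y - m l))\<^sup>2 - 4 * d\<^sup>2" for k l
  proof -
    let ?h = "complex_of_real (1/2) *\<^sub>C (m k + m l)"
    have "(y - m l) + (y - m k) = 2 *\<^sub>R (y - ?h)"
      by (simp add: scaleR_2 scaleR_diff_right scaleR_scaleC[symmetric] del: of_real_divide)
    moreover have "d \<le> norm (y - ?h)"
      by (intro d_le scale add m)
    ultimately have "2 * d \<le> norm ((y - m l) + (y - m k))"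
      by simp
    then have "(2 * d)\<^sup>2 \<le> (norm ((y - m l) + (y - m k)))\<^sup>2"
      using d_nonneg by (intro power_mono) auto
    then show ?thesis
      using parallelogram_law[of "y - m l" "y - m k"] by (simp add: power_mult_distrib)
  qed
  have "Cauchy m"
  proof (rule metric_CauchyI)
    fix e :: real assume "0 < e"
    have "(\<lambda>n. (norm (y - m n))\<^sup>2) \<longlonglongrightarrow> d\<^sup>2"
      by (intro tendsto_power lim_d)
    then have "\<forall>\<^sub>F n in sequentially. (norm (y - m n))\<^sup>2 < d\<^sup>2 + e\<^sup>2 / 4"
      using \<open>0 < e\<close> by (intro order_tendstoD(2)) auto
    then obtain N where N: "\<And>n. N \<le> n \<Longrightarrow> (norm (y - m n))\<^sup>2 < d\<^sup>2 + e\<^sup>2 / 4"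
      unfolding eventually_sequentially by blast
    have "dist (m k) (m l) < e" if "N \<le> k" "N \<le> l" for k l
    proof -
      have "(norm (m k - m l))\<^sup>2 < e\<^sup>2"
        using close[of k l] N[OF that(1)] N[OF that(2)] by linarith
      then show ?thesis
        using \<open>0 < e\<close> by (simp add: dist_norm power_less_imp_less_base)
    qed
    then show "\<exists>N. \<forall>k\<ge>N. \<forall>l\<ge>N. dist (m k) (m l) < e" by blast
  qed
  then obtain p where p: "m \<longlonglongrightarrow> p"
    using Cauchy_convergent convergent_def by blast
  have "p \<in> M"
    using closed_sequentially[OF closed] m p by blast
  have norm_p: "norm (y - p) = d"
    by (rule LIMSEQ_unique[OF tendsto_norm[OF tendsto_diff[OF tendsto_const p]] lim_d])
  have "cinner (y - p) u = 0" if "u \<in> M" for u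
  proof (cases "u = 0")
    case False
    let ?q = "(cinner (y - p) u / (norm u)\<^sup>2) *\<^sub>C u"
    have "d \<le> norm (y - (p + ?q))"
      by (intro d_le add scale \<open>p \<in> M\<close> that)
    then have "d\<^sup>2 \<le> (norm (y - p - ?q))\<^sup>2"
      using d_nonneg by (intro power_mono) (simp_all add: diff_diff_eq)
    then have "(cmod (cinner (y - p) u))\<^sup>2 / (norm u)\<^sup>2 \<le> 0"
      using norm_diff_projection_squared[OF False, of "y - p"] norm_p by simp
    then show ?thesis
      using False by (simp add: divide_le_0_iff)
  qed simp
  moreover have "y - p \<noteq> 0"
    using \<open>p \<in> M\<close> y by auto
  ultimately show ?thesis using that by blast
qed

text \<open>The representing vector is a multiple of a vector orthogonal to the kernel of \<open>f\<close>.\<close>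

lemma Riesz_representation:
  fixes f :: "'a :: complex_hilbert \<Rightarrow> complex"
  assumes f: "bounded_linear f" and f_scale: "\<And>a x. f (a *\<^sub>C x) = a * f x"
  obtains y where "\<And>x. f x = cinner x y"
proof (cases "\<forall>x. f x = 0")
  case True
  then show ?thesis using that[of 0] by simp
next
  case False
  interpret bounded_linear f by (rule f)
  have "closed (f -` {0})"
    by (intro closed_vimage closed_singleton linear_continuous_on f)
  then obtain w where w: "w \<noteq> 0" and orth: "\<And>u. u \<in> f -` {0} \<Longrightarrow> cinner w u = 0"
    using False closed_subspace_orthogonal_vector[of "f -` {0}"]
    by (auto simp: zero add f_scale)
  have ker: "cinner u w = 0" if "f u = 0" for u
    using orth[of u] that cinner_commute[of u w] by simp
  have "f w \<noteq> 0"
    using w ker[of w] by (auto simp: cinner_eq_zero_iff)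
  have "f x = cinner x (cnj (f w / (norm w)\<^sup>2) *\<^sub>C w)" for x
  proof -
    have "f (x - (f x / f w) *\<^sub>C w) = 0"
      using \<open>f w \<noteq> 0\<close> by (simp add: diff f_scale)
    then have "cinner x w = f x / f w * (norm w)\<^sup>2"
      using ker[of "x - (f x / f w) *\<^sub>C w"]
      by (simp add: cinner_diff_left cinner_scaleC_left cinner_self)
    then show ?thesis
      using w \<open>f w \<noteq> 0\<close> by (simp add: cinner_scaleC_right)
  qed
  then show ?thesis by (rule that)
qed


section \<open>Bounded operators and their adjoints\<close>

lemma cblinfun_exists:
  fixes f :: "'a :: complex_normed_vector \<Rightarrow> 'b :: complex_normed_vector"
  assumes "\<And>x y. f (x + y) = f x + f y" and scale: "\<And>a x. f (a *\<^sub>C x) = a *\<^sub>C f x"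
    and "\<And>x. norm (f x) \<le> K * norm x"
  obtains T where "\<And>x. T *\<^sub>V x = f x"
proof -
  have bl: "bounded_linear f"
    by (rule bounded_linear_intro[where K = K])
      (use assms in \<open>simp_all add: scaleR_scaleC mult.commute\<close>)
  have "Abs_cblinfun (Blinfun f) *\<^sub>V x = f x" for x
    using bl scale
    by (simp add: cblinfun_apply.rep_eq Abs_cblinfun_inverse bounded_linear_Blinfun_apply)
  then show ?thesis by (rule that)
qed

lemma cblinfun_eqI:
  assumes "\<And>x. S *\<^sub>V x = T *\<^sub>V x"
  shows "S = T"
  using assms by transfer (rule blinfun_eqI)

lemma bounded_linear_cblinfun_apply: "bounded_linear (cblinfun_apply T)"
  by transfer (rule blinfun.bounded_linear_right)

lemmas cblinfun_apply_add = linear_add[OF bounded_linear.linear[OF bounded_linear_cblinfun_apply]]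
lemmas cblinfun_apply_diff = linear_diff[OF bounded_linear.linear[OF bounded_linear_cblinfun_apply]]
lemmas cblinfun_apply_zero = linear_0[OF bounded_linear.linear[OF bounded_linear_cblinfun_apply]]

lemma cblinfun_apply_scaleC: "T *\<^sub>V (a *\<^sub>C x) = a *\<^sub>C (T *\<^sub>V x)"
  by transfer simp

lemma norm_cblinfun_apply: "norm (T *\<^sub>V x) \<le> norm T * norm x"
  by transfer (rule norm_blinfun)

lemma norm_cblinfun_bound:
  assumes "0 \<le> b" "\<And>x. norm (T *\<^sub>V x) \<le> b * norm x"
  shows "norm T \<le> b"
  using assms by transfer (rule norm_blinfun_bound)

lemma norm_cblinfun_compose: "norm (S o\<^sub>C\<^sub>L T) \<le> norm S * norm T"
  by transfer (rule norm_blinfun_compose)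

lemma cblinfun_compose_add_scaleC_right:
  "R o\<^sub>C\<^sub>L (S + a *\<^sub>C T) = (R o\<^sub>C\<^sub>L S) + a *\<^sub>C (R o\<^sub>C\<^sub>L T)"
  by (rule cblinfun_eqI) (simp add: cblinfun_apply_add cblinfun_apply_scaleC)

lemma norm_cblinfun_approx:
  fixes T :: "'a :: complex_normed_vector \<Rightarrow>\<^sub>C\<^sub>L 'b :: complex_normed_vector"
  assumes nonzero: "\<exists>x :: 'a. x \<noteq> 0" and "0 < e"
  obtains x where "norm x = 1" "norm T - e < norm (T *\<^sub>V x)"
proof (rule ccontr)
  assume "\<not> thesis"
  with that have le: "norm (T *\<^sub>V x) \<le> norm T - e" if "norm x = 1" for x
    using \<open>norm x = 1\<close> by (meson not_le)
  obtain x0 :: 'a where "x0 \<noteq> 0" using nonzero by blast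
  then have "0 \<le> norm T - e"
    using le[of "sgn x0"] norm_ge_zero[of "T *\<^sub>V sgn x0"] by (simp add: norm_sgn del: norm_ge_zero)
  moreover have "norm (T *\<^sub>V x) \<le> (norm T - e) * norm x" for x
  proof (cases "x = 0")
    case True
    then show ?thesis by (simp add: cblinfun_apply_zero)
  next
    case False
    have "T *\<^sub>V x = norm x *\<^sub>R (T *\<^sub>V sgn x)"
      using False by (simp add: scaleR_scaleC scaleC_scaleC scaleC_one sgn_div_norm
          flip: cblinfun_apply_scaleC)
    then show ?thesis
      using le[of "sgn x"] False by (simp add: norm_sgn mult.commute mult_left_mono)
  qed
  ultimately have "norm T \<le> norm T - e"
    by (rule norm_cblinfun_bound)
  with \<open>0 < e\<close> show False by simp
qed

lemma adj_exists:
  fixes T :: "'a :: complex_hilbert \<Rightarrow>\<^sub>C\<^sub>L 'b :: complex_hilbert"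
  obtains S where "\<And>x y. cinner (T *\<^sub>V x) y = cinner x (S *\<^sub>V y)"
proof -
  have "\<exists>z. \<forall>x. cinner (T *\<^sub>V x) y = cinner x z" for y
  proof (rule Riesz_representation[of "\<lambda>x. cinner (T *\<^sub>V x) y"])
    show "bounded_linear (\<lambda>x. cinner (T *\<^sub>V x) y)"
      by (rule bounded_linear_compose[OF bounded_linear_cinner_left bounded_linear_cblinfun_apply])
  qed (auto simp: cblinfun_apply_scaleC cinner_scaleC_left)
  then obtain s where s: "\<And>x y. cinner (T *\<^sub>V x) y = cinner x (s y)"
    by metis
  have "norm (s y) \<le> norm T * norm y" for y
  proof (cases "s y = 0")
    case False
    have "(norm (s y))\<^sup>2 = cmod (cinner (T *\<^sub>V s y) y)"
      by (simp add: s cinner_self flip: of_real_power)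
    also have "\<dots> \<le> norm T * norm (s y) * norm y"
      by (meson complex_Cauchy_Schwarz norm_cblinfun_apply norm_ge_zero mult_right_mono order_trans)
    finally show ?thesis
      using False by (simp add: power2_eq_square mult.commute mult.left_commute)
  qed simp
  moreover have "s (x + y) = s x + s y" for x y
    by (rule cinner_extensionality) (simp add: cinner_add_right flip: s)
  moreover have "s (a *\<^sub>C x) = a *\<^sub>C s x" for a x
    by (rule cinner_extensionality) (simp add: cinner_scaleC_right flip: s)
  ultimately obtain S where "\<And>y. S *\<^sub>V y = s y"
    by (metis cblinfun_exists)
  then show ?thesis using that[of S] s by simp
qed

lemma cinner_adj: "cinner (T *\<^sub>V x) y = cinner x (adj T *\<^sub>V y)"
proof -
  obtain S where S: "\<And>x y. cinner (T *\<^sub>V x) y = cinner x (S *\<^sub>V y)"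
    using adj_exists by blast
  have "\<forall>x y. cinner (T *\<^sub>V x) y = cinner x (adj T *\<^sub>V y)"
    unfolding adj_def
  proof (rule theI[of _ S])
    fix S' assume "\<forall>x y. cinner (T *\<^sub>V x) y = cinner x (S' *\<^sub>V y)"
    then show "S' = S"
      using S by (intro cblinfun_eqI cinner_extensionality) metis
  qed (use S in blast)
  then show ?thesis by blast
qed

lemma cinner_adj_left: "cinner (adj T *\<^sub>V x) y = cinner x (T *\<^sub>V y)"
  by (metis cinner_adj cinner_commute)

lemma norm_adj_compose_self: "(norm T)\<^sup>2 \<le> norm (adj T o\<^sub>C\<^sub>L T)"
proof -
  have "norm (T *\<^sub>V x) \<le> sqrt (norm (adj T o\<^sub>C\<^sub>L T)) * norm x" for x
  proof (rule power2_le_imp_le)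
    have "(norm (T *\<^sub>V x))\<^sup>2 = cmod (cinner ((adj T o\<^sub>C\<^sub>L T) *\<^sub>V x) x)"
      by (simp add: cinner_adj_left cinner_self norm_power flip: of_real_power)
    also have "\<dots> \<le> norm (adj T o\<^sub>C\<^sub>L T) * norm x * norm x"
      by (meson complex_Cauchy_Schwarz norm_cblinfun_apply norm_ge_zero mult_right_mono order_trans)
    finally show "(norm (T *\<^sub>V x))\<^sup>2 \<le> (sqrt (norm (adj T o\<^sub>C\<^sub>L T)) * norm x)\<^sup>2"
      by (simp add: power_mult_distrib power2_eq_square[of "norm x"] mult.assoc)
  qed simp
  then have "norm T \<le> sqrt (norm (adj T o\<^sub>C\<^sub>L T))"
    by (intro norm_cblinfun_bound) auto
  then have "(norm T)\<^sup>2 \<le> (sqrt (norm (adj T o\<^sub>C\<^sub>L T)))\<^sup>2"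
    by (intro power_mono) auto
  then show ?thesis by simp
qed

lemma norm_adj_le: "norm (adj T) \<le> norm T"
proof (rule norm_cblinfun_bound)
  fix y
  show "norm (adj T *\<^sub>V y) \<le> norm T * norm y"
  proof (cases "adj T *\<^sub>V y = 0")
    case False
    have "(norm (adj T *\<^sub>V y))\<^sup>2 = cmod (cinner (T *\<^sub>V adj T *\<^sub>V y) y)"
      by (simp add: cinner_adj cinner_self norm_power flip: of_real_power)
    also have "\<dots> \<le> norm T * norm (adj T *\<^sub>V y) * norm y"
      by (meson complex_Cauchy_Schwarz norm_cblinfun_apply norm_ge_zero mult_right_mono order_trans)
    finally show ?thesis
      using False by (simp add: power2_eq_square mult.commute mult.left_commute)
  qed simp
qed simp

lemma norm_adj_compose_le: "norm (adj S o\<^sub>C\<^sub>L T) \<le> norm S * norm T"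
  by (meson norm_adj_le norm_cblinfun_compose norm_ge_zero mult_right_mono order_trans)


section \<open>Spectrum and numerical range\<close>

text \<open>
  The range of such an operator is complete, hence closed, and nothing is orthogonal to it, so it
  is the whole space; the lower bound makes the set-theoretic inverse bounded.
\<close>

lemma cblinfun_invertible:
  fixes B :: "'a :: complex_hilbert \<Rightarrow>\<^sub>C\<^sub>L 'b :: complex_hilbert"
  assumes "0 < d" and below: "\<And>x. d * norm x \<le> norm (B *\<^sub>V x)"
    and orth: "\<And>w. (\<And>x. cinner w (B *\<^sub>V x) = 0) \<Longrightarrow> w = 0"
  obtains S where "S o\<^sub>C\<^sub>L B = cblinfun_id" "B o\<^sub>C\<^sub>L S = cblinfun_id"
proof -
  have "complete (range (cblinfun_apply B))"
    by (rule complete_isometric_image[OF \<open>0 < d\<close> subspace_UNIV bounded_linear_cblinfun_apply])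
      (use below in \<open>auto simp: complete_UNIV\<close>)
  then have closed: "closed (range (cblinfun_apply B))"
    by (rule complete_imp_closed)
  have surj: "y \<in> range (cblinfun_apply B)" for y
  proof (rule ccontr)
    assume "y \<notin> range (cblinfun_apply B)"
    then obtain w where "w \<noteq> 0" "\<And>u. u \<in> range (cblinfun_apply B) \<Longrightarrow> cinner w u = 0"
    proof (rule closed_subspace_orthogonal_vector[OF closed, rotated -2])
      show "0 \<in> range (cblinfun_apply B)"
        by (rule range_eqI[of _ _ 0]) (simp add: cblinfun_apply_zero)
    qed (auto simp flip: cblinfun_apply_add cblinfun_apply_scaleC)
    then show False using orth by blast
  qed
  then obtain s where B_s: "\<And>y. B *\<^sub>V s y = y"
    unfolding image_iff by metis
  have inj: "x = x'" if "B *\<^sub>V x = B *\<^sub>V x'" for x x'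
    using below[of "x - x'"] \<open>0 < d\<close> that by (simp add: cblinfun_apply_diff mult_le_0_iff)
  have s_add: "s (x + y) = s x + s y" for x y
    by (rule inj) (simp add: B_s cblinfun_apply_add)
  have s_scale: "s (a *\<^sub>C x) = a *\<^sub>C s x" for a x
    by (rule inj) (simp add: B_s cblinfun_apply_scaleC)
  have s_bound: "norm (s y) \<le> inverse d * norm y" for y
    using below[of "s y"] \<open>0 < d\<close> by (simp add: B_s field_simps)
  obtain S where S: "\<And>y. S *\<^sub>V y = s y"
    using cblinfun_exists[OF s_add s_scale s_bound] by auto
  show ?thesis
    by (rule that[of S]; rule cblinfun_eqI) (auto simp: S B_s intro: inj)
qed

text \<open>
  If \<open>z\<close> has distance \<open>\<epsilon>\<close> from the numerical range of \<open>A\<close>, then \<open>A - z\<close> is bounded below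
  by \<open>\<epsilon>\<close>, and a vector \<open>w\<close> orthogonal to its range vanishes since \<open>\<epsilon> |w|\<^sup>2 \<le> |((A - z) w | w)|\<close>.
  So \<open>A - z\<close> is invertible.
\<close>

lemma spectrum_subset_closure_numerical_range:
  fixes A :: "'a :: complex_hilbert \<Rightarrow>\<^sub>C\<^sub>L 'a"
  assumes "z \<in> spectrum A" "0 < e"
  obtains x where "norm x = 1" "cmod (cinner (A *\<^sub>V x) x - z) < e"
proof (rule ccontr)
  assume "\<not> thesis"
  with that have far: "e \<le> cmod (cinner (A *\<^sub>V x) x - z)" if "norm x = 1" for x
    using \<open>norm x = 1\<close> by (meson not_le)
  define B where "B = A - z *\<^sub>C cblinfun_id"
  have coercive: "e * (norm x)\<^sup>2 \<le> cmod (cinner (B *\<^sub>V x) x)" for x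
  proof (cases "x = 0")
    case False
    define u where "u = sgn x"
    have u: "norm u = 1" and x: "x = complex_of_real (norm x) *\<^sub>C u"
      using False by (simp_all add: u_def norm_sgn sgn_div_norm flip: scaleR_scaleC)
    have "cinner (B *\<^sub>V u) u = cinner (A *\<^sub>V u) u - z"
      using u by (simp add: B_def cinner_diff_left cinner_scaleC_left cinner_self)
    moreover have "cinner (B *\<^sub>V x) x = (norm x)\<^sup>2 * cinner (B *\<^sub>V u) u"
      by (subst (1 2) x)
        (simp add: cblinfun_apply_scaleC cinner_scaleC_left cinner_scaleC_right power2_eq_square)
    ultimately have "cmod (cinner (B *\<^sub>V x) x) = (norm x)\<^sup>2 * cmod (cinner (A *\<^sub>V u) u - z)"
      by (simp add: norm_mult norm_power)
    then show ?thesis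
      using mult_left_mono[OF far[OF u], of "(norm x)\<^sup>2"] by (simp add: mult.commute)
  qed simp
  have below: "e * norm x \<le> norm (B *\<^sub>V x)" for x
  proof (cases "x = 0")
    case False
    have "e * norm x * norm x \<le> norm (B *\<^sub>V x) * norm x"
      using coercive[of x] complex_Cauchy_Schwarz[of "B *\<^sub>V x" x]
      by (simp add: power2_eq_square mult.assoc)
    then show ?thesis using False by simp
  qed simp
  have orth: "w = 0" if "\<And>x. cinner w (B *\<^sub>V x) = 0" for w
    using coercive[of w] that[of w] cinner_commute[of "B *\<^sub>V w" w] \<open>0 < e\<close>
    by (simp add: mult_le_0_iff)
  obtain S where "S o\<^sub>C\<^sub>L B = cblinfun_id" "B o\<^sub>C\<^sub>L S = cblinfun_id"
    by (rule cblinfun_invertible[OF \<open>0 < e\<close> below orth])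
  then show False
    using \<open>z \<in> spectrum A\<close> by (auto simp: spectrum_def B_def)
qed

lemma cmod_cinner_le_norm:
  assumes "norm x = 1"
  shows "cmod (cinner (A *\<^sub>V x) x) \<le> norm A"
  using complex_Cauchy_Schwarz[of "A *\<^sub>V x" x] norm_cblinfun_apply[of A x] assms by simp

lemma spectrum_norm_bound:
  fixes A :: "'a :: complex_hilbert \<Rightarrow>\<^sub>C\<^sub>L 'a"
  assumes "z \<in> spectrum A"
  shows "cmod z \<le> norm A"
proof (rule field_le_epsilon)
  fix e :: real assume "0 < e"
  with assms obtain x where "norm x = 1" "cmod (cinner (A *\<^sub>V x) x - z) < e"
    by (rule spectrum_subset_closure_numerical_range)
  then show "cmod z \<le> norm A + e"
    using cmod_cinner_le_norm[of x A] norm_triangle_ineq4[of "cinner (A *\<^sub>V x) x" "cinner (A *\<^sub>V x) x - z"]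
    by simp
qed

lemma approximate_eigenvalue_in_spectrum:
  assumes unit: "\<And>n. norm (\<xi> n) = 1" and lim: "(\<lambda>n. A *\<^sub>V \<xi> n - z *\<^sub>C \<xi> n) \<longlonglongrightarrow> 0"
  shows "z \<in> spectrum A"
proof (rule ccontr)
  assume "z \<notin> spectrum A"
  then obtain S where S: "S o\<^sub>C\<^sub>L (A - z *\<^sub>C cblinfun_id) = cblinfun_id"
    by (auto simp: spectrum_def)
  have "(\<lambda>n. S *\<^sub>V (A *\<^sub>V \<xi> n - z *\<^sub>C \<xi> n)) \<longlonglongrightarrow> S *\<^sub>V 0"
    by (rule bounded_linear.tendsto[OF bounded_linear_cblinfun_apply lim])
  moreover have "S *\<^sub>V (A *\<^sub>V \<xi> n - z *\<^sub>C \<xi> n) = \<xi> n" for n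
    using arg_cong[OF S, of "\<lambda>T. T *\<^sub>V \<xi> n"] by simp
  ultimately have "(\<lambda>n. norm (\<xi> n)) \<longlonglongrightarrow> 0"
    by (simp add: cblinfun_apply_zero tendsto_norm_zero)
  then show False
    using unit by (simp add: LIMSEQ_const_iff)
qed

text \<open>
  Were the spectrum empty, every matrix coefficient of the resolvent \<open>R z\<close> would be an entire
  function that vanishes at infinity.  Its derivative is computed from the resolvent identity
  \<open>R z - R w = (z - w) R z R w\<close>, and Liouville's theorem then gives \<open>R z = 0\<close>.
\<close>

lemma spectrum_nonempty:
  fixes A :: "'a :: complex_hilbert \<Rightarrow>\<^sub>C\<^sub>L 'a"
  assumes nonzero: "\<exists>x :: 'a. x \<noteq> 0"
  shows "spectrum A \<noteq> {}"
proof
  assume empty: "spectrum A = {}"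
  have "\<exists>S. S o\<^sub>C\<^sub>L (A - z *\<^sub>C cblinfun_id) = cblinfun_id
          \<and> (A - z *\<^sub>C cblinfun_id) o\<^sub>C\<^sub>L S = cblinfun_id" for z
    using empty unfolding spectrum_def by blast
  then obtain R where R: "\<And>z. R z o\<^sub>C\<^sub>L (A - z *\<^sub>C cblinfun_id) = cblinfun_id"
      "\<And>z. (A - z *\<^sub>C cblinfun_id) o\<^sub>C\<^sub>L R z = cblinfun_id"
    by metis
  have R_left: "R z *\<^sub>V (A *\<^sub>V x - z *\<^sub>C x) = x" for z x
    using arg_cong[OF R(1), of "\<lambda>T. T *\<^sub>V x"] by simp
  have R_right: "A *\<^sub>V (R z *\<^sub>V x) - z *\<^sub>C (R z *\<^sub>V x) = x" for z x
    using arg_cong[OF R(2), of "\<lambda>T. T *\<^sub>V x"] by simp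
  have resolvent: "R z *\<^sub>V x - R w *\<^sub>V x = (z - w) *\<^sub>C (R z *\<^sub>V R w *\<^sub>V x)" for z w x
  proof -
    have "x = (A *\<^sub>V (R w *\<^sub>V x) - z *\<^sub>C (R w *\<^sub>V x)) + (z - w) *\<^sub>C (R w *\<^sub>V x)"
      using R_right[of w x] scaleC_add_left[of "z - w" w "R w *\<^sub>V x"] by (simp add: algebra_simps)
    then have "R z *\<^sub>V x = R z *\<^sub>V (A *\<^sub>V (R w *\<^sub>V x) - z *\<^sub>C (R w *\<^sub>V x))
        + R z *\<^sub>V ((z - w) *\<^sub>C (R w *\<^sub>V x))"
      by (metis cblinfun_apply_add)
    then show ?thesis
      by (simp add: R_left cblinfun_apply_scaleC)
  qed
  have R_norm: "norm (R z *\<^sub>V x) * (cmod z - norm A) \<le> norm x" for z x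
  proof -
    have "cmod z * norm (R z *\<^sub>V x) - norm (A *\<^sub>V (R z *\<^sub>V x)) \<le> norm x"
      using norm_triangle_ineq2[of "z *\<^sub>C (R z *\<^sub>V x)" "A *\<^sub>V (R z *\<^sub>V x)"] R_right[of z x]
      by (simp add: norm_scaleC norm_minus_commute)
    then show ?thesis
      using norm_cblinfun_apply[of A "R z *\<^sub>V x"] by (simp add: algebra_simps)
  qed
  \<comment> \<open>Local boundedness of the resolvent; through the resolvent identity it gives continuity.\<close>
  have R_bound: "norm (R z) \<le> 2 * norm (R w)" if "cmod (z - w) * norm (R w) \<le> 1 / 2" for z w
  proof -
    have "norm (R z) \<le> norm (R w) + cmod (z - w) * (norm (R z) * norm (R w))"
    proof (rule norm_cblinfun_bound)
      fix x
      have "norm (R z *\<^sub>V x - R w *\<^sub>V x) \<le> cmod (z - w) * (norm (R z) * (norm (R w) * norm x))"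
        unfolding resolvent norm_scaleC
        by (meson norm_cblinfun_apply norm_ge_zero mult_left_mono order_trans)
      then show "norm (R z *\<^sub>V x) \<le> (norm (R w) + cmod (z - w) * (norm (R z) * norm (R w))) * norm x"
        using norm_triangle_ineq2[of "R z *\<^sub>V x" "R w *\<^sub>V x"] norm_cblinfun_apply[of "R w" x]
        by (simp add: algebra_simps)
    qed simp
    then show ?thesis
      using mult_right_mono[OF that norm_ge_zero[of "R z"]] by (simp add: algebra_simps)
  qed
  have R_tendsto: "((\<lambda>z. R z *\<^sub>V x) \<longlongrightarrow> R w *\<^sub>V x) (at w)" for w x
  proof (rule LIM_zero_cancel, rule Lim_null_comparison)
    have "((\<lambda>z. cmod (z - w) * norm (R w)) \<longlongrightarrow> cmod (w - w) * norm (R w)) (at w)"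
      by (intro tendsto_intros)
    then have "\<forall>\<^sub>F z in at w. cmod (z - w) * norm (R w) < 1 / 2"
      by (intro order_tendstoD(2)) auto
    then show "\<forall>\<^sub>F z in at w. norm (R z *\<^sub>V x - R w *\<^sub>V x)
        \<le> cmod (z - w) * (2 * norm (R w) * (norm (R w) * norm x))"
    proof eventually_elim
      fix z assume "cmod (z - w) * norm (R w) < 1 / 2"
      then have "norm (R z) \<le> 2 * norm (R w)"
        by (intro R_bound) simp
      then have "norm (R z *\<^sub>V R w *\<^sub>V x) \<le> 2 * norm (R w) * (norm (R w) * norm x)"
        by (intro order_trans[OF norm_cblinfun_apply] mult_mono norm_cblinfun_apply) auto
      then show "norm (R z *\<^sub>V x - R w *\<^sub>V x)
          \<le> cmod (z - w) * (2 * norm (R w) * (norm (R w) * norm x))"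
        unfolding resolvent norm_scaleC by (rule mult_left_mono) simp
    qed
    have "((\<lambda>z. cmod (z - w) * (2 * norm (R w) * (norm (R w) * norm x)))
        \<longlongrightarrow> cmod (w - w) * (2 * norm (R w) * (norm (R w) * norm x))) (at w)"
      by (intro tendsto_intros)
    then show "((\<lambda>z. cmod (z - w) * (2 * norm (R w) * (norm (R w) * norm x))) \<longlongrightarrow> 0) (at w)"
      by simp
  qed
  have coefficient_zero: "cinner (R z *\<^sub>V x) y = 0" for z x y
  proof (rule Liouville_weak_0[where f = "\<lambda>z. cinner (R z *\<^sub>V x) y"])
    have "((\<lambda>z. cinner (R z *\<^sub>V x) y) has_field_derivative cinner (R w *\<^sub>V R w *\<^sub>V x) y) (at w)" for w
      unfolding has_field_derivative_iff
    proof (rule Lim_transform_eventually)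
      show "((\<lambda>z. cinner (R z *\<^sub>V R w *\<^sub>V x) y) \<longlongrightarrow> cinner (R w *\<^sub>V R w *\<^sub>V x) y) (at w)"
        by (rule bounded_linear.tendsto[OF bounded_linear_cinner_left R_tendsto])
      have "\<forall>\<^sub>F z in at w. z \<noteq> w"
        by (simp add: eventually_at_filter)
      then show "\<forall>\<^sub>F z in at w. cinner (R z *\<^sub>V R w *\<^sub>V x) y
          = (cinner (R z *\<^sub>V x) y - cinner (R w *\<^sub>V x) y) / (z - w)"
        by eventually_elim (simp add: resolvent cinner_scaleC_left flip: cinner_diff_left)
    qed
    then show "(\<lambda>z. cinner (R z *\<^sub>V x) y) holomorphic_on UNIV"
      by (auto simp: holomorphic_on_open)
    show "((\<lambda>z. cinner (R z *\<^sub>V x) y) \<longlongrightarrow> 0) at_infinity"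
    proof (rule Lim_null_comparison)
      have "\<forall>\<^sub>F z in at_infinity. norm A + 1 \<le> cmod z"
        by (auto simp: eventually_at_infinity)
      then show "\<forall>\<^sub>F z in at_infinity.
          cmod (cinner (R z *\<^sub>V x) y) \<le> norm x * norm y / (cmod z - norm A)"
      proof eventually_elim
        fix z assume "norm A + 1 \<le> cmod z"
        then have "norm (R z *\<^sub>V x) \<le> norm x / (cmod z - norm A)"
          using R_norm[of z x] by (simp add: pos_le_divide_eq)
        then have "norm (R z *\<^sub>V x) * norm y \<le> norm x / (cmod z - norm A) * norm y"
          by (rule mult_right_mono) simp
        then show "cmod (cinner (R z *\<^sub>V x) y) \<le> norm x * norm y / (cmod z - norm A)"
          using complex_Cauchy_Schwarz[of "R z *\<^sub>V x" y] by simp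
      qed
      show "((\<lambda>z. norm x * norm y / (cmod z - norm A)) \<longlongrightarrow> 0) at_infinity"
        by (intro tendsto_divide_0[OF tendsto_const] filterlim_at_top_imp_at_infinity)
          (use filterlim_tendsto_add_at_top[OF tendsto_const[of "- norm A"] filterlim_norm_at_top]
            in \<open>simp add: algebra_simps\<close>)
    qed
  qed
  obtain x :: 'a where "x \<noteq> 0" using nonzero by blast
  have "R 0 *\<^sub>V x = 0"
    using coefficient_zero[of 0 x "R 0 *\<^sub>V x"] by (simp add: cinner_eq_zero_iff)
  then show False
    using R_right[of 0 x] \<open>x \<noteq> 0\<close> by (simp add: cblinfun_apply_zero scaleC_zero_right)
qed

lemma spectral_radius_le_norm:
  fixes A :: "'a :: complex_hilbert \<Rightarrow>\<^sub>C\<^sub>L 'a"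
  assumes "\<exists>x :: 'a. x \<noteq> 0"
  shows "spectral_radius A \<le> norm A"
  unfolding spectral_radius_def
  by (intro cSUP_least spectrum_nonempty[OF assms] spectrum_norm_bound)

lemma cmod_le_spectral_radius:
  fixes A :: "'a :: complex_hilbert \<Rightarrow>\<^sub>C\<^sub>L 'a"
  assumes "z \<in> spectrum A"
  shows "cmod z \<le> spectral_radius A"
  unfolding spectral_radius_def
  by (rule cSUP_upper[OF assms]) (auto intro: bdd_aboveI2 spectrum_norm_bound)

lemma tendsto_zero_if_norm_squared_le:
  fixes f :: "nat \<Rightarrow> 'a :: real_normed_vector"
  assumes "\<And>n. (norm (f n))\<^sup>2 \<le> g n" "g \<longlonglongrightarrow> 0"
  shows "f \<longlonglongrightarrow> 0"
proof (rule Lim_null_comparison)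
  show "\<forall>\<^sub>F n in sequentially. norm (f n) \<le> sqrt (g n)"
    using assms(1) by (simp add: real_le_rsqrt)
  show "(\<lambda>n. sqrt (g n)) \<longlonglongrightarrow> 0"
    using tendsto_real_sqrt[OF assms(2)] by simp
qed

text \<open>
  Near equality in \<open>Re w \<le> \<bar>w\<bar> \<le> r\<close> forces \<open>w\<close> to be close to \<open>r\<close>.
\<close>

lemma cmod_diff_real_squared_le:
  assumes "cmod w \<le> r"
  shows "(cmod (w - complex_of_real r))\<^sup>2 \<le> 2 * r * (r - Re w)"
proof -
  have "(cmod w)\<^sup>2 \<le> r\<^sup>2"
    using assms by (intro power_mono) auto
  then show ?thesis
    by (simp add: cmod_power2) (simp add: power2_eq_square algebra_simps)
qed

text \<open>
  If the numerical range of \<open>A\<close> approaches a number of modulus at least \<open>|A|\<close> along \<open>\<xi>\<close>, then the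
  equality case of the Cauchy-Schwarz inequality makes that number an approximate eigenvalue.
  Conversely, a spectral value of nearly maximal modulus is nearly a value of the numerical range,
  and compactness of closed discs provides a common limit.
\<close>

lemma numerical_range_limit_iff_spectral_radius:
  fixes A :: "'a :: complex_hilbert \<Rightarrow>\<^sub>C\<^sub>L 'a"
  assumes nonzero: "\<exists>x :: 'a. x \<noteq> 0" and norm_A: "norm A \<le> r"
  shows "(\<exists>\<xi> c. (\<forall>n :: nat. norm (\<xi> n) = 1) \<and> cmod c = 1
            \<and> (\<lambda>n. cinner (A *\<^sub>V \<xi> n) (\<xi> n)) \<longlonglongrightarrow> c * complex_of_real r)
         \<longleftrightarrow> spectral_radius A = norm A \<and> norm A = r"
    (is "?limit \<longleftrightarrow> ?radius")
proof
  assume ?limit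
  then obtain \<xi> c where unit: "\<And>n. norm (\<xi> n) = 1" and c: "cmod c = 1"
    and lim: "(\<lambda>n. cinner (A *\<^sub>V \<xi> n) (\<xi> n)) \<longlonglongrightarrow> c * complex_of_real r"
    by blast
  have "0 \<le> r" using norm_A norm_ge_zero[of A] by linarith
  define z where "z = c * complex_of_real r"
  have z: "cmod z = r" using c \<open>0 \<le> r\<close> by (simp add: z_def norm_mult)
  have "(\<lambda>n. A *\<^sub>V \<xi> n - z *\<^sub>C \<xi> n) \<longlonglongrightarrow> 0"
  proof (rule tendsto_zero_if_norm_squared_le)
    fix n
    have "norm (A *\<^sub>V \<xi> n) \<le> r"
      using norm_cblinfun_apply[of A "\<xi> n"] unit norm_A by simp
    then have "(norm (A *\<^sub>V \<xi> n))\<^sup>2 \<le> r\<^sup>2" by (intro power_mono) auto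
    then show "(norm (A *\<^sub>V \<xi> n - z *\<^sub>C \<xi> n))\<^sup>2
        \<le> 2 * r\<^sup>2 - 2 * Re (cnj z * cinner (A *\<^sub>V \<xi> n) (\<xi> n))"
      by (simp add: norm_diff_squared norm_scaleC unit z cinner_scaleC_right)
  next
    have "(\<lambda>n. 2 * r\<^sup>2 - 2 * Re (cnj z * cinner (A *\<^sub>V \<xi> n) (\<xi> n)))
        \<longlonglongrightarrow> 2 * r\<^sup>2 - 2 * Re (cnj z * z)"
      using lim unfolding z_def by (intro tendsto_intros)
    moreover have "2 * r\<^sup>2 - 2 * Re (cnj z * z) = 0"
      using cmod_power2[of z] z by (simp add: power2_eq_square)
    ultimately show "(\<lambda>n. 2 * r\<^sup>2 - 2 * Re (cnj z * cinner (A *\<^sub>V \<xi> n) (\<xi> n))) \<longlonglongrightarrow> 0"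
      by (simp only:)
  qed
  then have "z \<in> spectrum A"
    by (intro approximate_eigenvalue_in_spectrum[OF unit])
  then have "r \<le> spectral_radius A"
    using cmod_le_spectral_radius z by metis
  then show ?radius
    using spectral_radius_le_norm[OF nonzero, of A] norm_A by linarith
next
  assume r: ?radius
  have "\<exists>x. norm x = 1 \<and> r - 2 / Suc n < cmod (cinner (A *\<^sub>V x) x)" for n
  proof -
    have "r - 1 / Suc n < (SUP z\<in>spectrum A. cmod z)"
      using r by (simp add: spectral_radius_def[symmetric])
    then obtain z where z: "z \<in> spectrum A" "r - 1 / Suc n < cmod z"
      using spectrum_nonempty[OF nonzero, of A]
      by (subst (asm) less_cSUP_iff) (auto intro: bdd_aboveI2 spectrum_norm_bound)
    obtain x where "norm x = 1" "cmod (cinner (A *\<^sub>V x) x - z) < 1 / Suc n"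
      using spectrum_subset_closure_numerical_range[OF z(1), of "1 / Suc n"] by auto
    then show ?thesis
      using z(2) norm_triangle_ineq4[of "cinner (A *\<^sub>V x) x" "cinner (A *\<^sub>V x) x - z"]
      by (intro exI[of _ x]) auto
  qed
  then obtain \<xi> where unit: "\<And>n. norm (\<xi> n) = 1"
    and large: "\<And>n. r - 2 / Suc n < cmod (cinner (A *\<^sub>V \<xi> n) (\<xi> n))"
    by metis
  have small: "cmod (cinner (A *\<^sub>V \<xi> n) (\<xi> n)) \<le> r" for n
    using cmod_cinner_le_norm[OF unit] norm_A order_trans by blast
  have "bounded (range (\<lambda>n. cinner (A *\<^sub>V \<xi> n) (\<xi> n)))"
    using small by (auto simp: bounded_iff)
  then obtain l \<rho> where \<rho>: "strict_mono (\<rho> :: nat \<Rightarrow> nat)"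
    and l: "((\<lambda>n. cinner (A *\<^sub>V \<xi> n) (\<xi> n)) \<circ> \<rho>) \<longlonglongrightarrow> l"
    using bounded_imp_convergent_subsequence by blast
  have "(\<lambda>n. cmod (cinner (A *\<^sub>V \<xi> n) (\<xi> n))) \<longlonglongrightarrow> r"
  proof (rule tendsto_sandwich[of "\<lambda>n. r - 2 / Suc n" _ _ "\<lambda>_. r"])
    show "(\<lambda>n. r - 2 / real (Suc n)) \<longlonglongrightarrow> r"
      using tendsto_diff[OF tendsto_const tendsto_mult[OF tendsto_const LIMSEQ_inverse_real_of_nat], of r 2]
      by (simp add: inverse_eq_divide)
  qed (use less_imp_le[OF large] small in simp_all)
  then have "((\<lambda>n. cmod (cinner (A *\<^sub>V \<xi> n) (\<xi> n))) \<circ> \<rho>) \<longlonglongrightarrow> r"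
    using \<rho> by (rule LIMSEQ_subseq_LIMSEQ)
  then have norm_l: "cmod l = r"
    using tendsto_norm[OF l] by (intro LIMSEQ_unique) (auto simp: o_def)
  \<comment> \<open>For \<open>l = 0\<close> the direction of \<open>l\<close> is undefined, and any unimodular number will do.\<close>
  define c where "c = (if l = 0 then 1 else sgn l)"
  have "cmod c = 1"
    by (simp add: c_def norm_sgn)
  moreover have "c * complex_of_real r = l"
    using norm_l by (auto simp: c_def sgn_eq)
  ultimately show ?limit
    using l unit by (intro exI[of _ "\<xi> \<circ> \<rho>"] exI[of _ c]) (auto simp: o_def)
qed


section \<open>Parallel operators\<close>

text \<open>
  In \<open>|T1 \<xi> + c T2 \<xi>|\<^sup>2 = |T1 \<xi>|\<^sup>2 + |T2 \<xi>|\<^sup>2 + 2 Re (cnj c (T1 \<xi> | T2 \<xi>))\<close> the left side can be close to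
  \<open>(|T1| + |T2|)\<^sup>2\<close> only if all three terms on the right are close to their maxima.  Conversely,
  by the Cauchy-Schwarz inequality, a nearly maximal last term forces the other two to be nearly
  maximal, unless one of the operators is zero; and then they are parallel anyway.
\<close>

lemma parallel_iff_cinner_limit:
  fixes T1 T2 :: "'a :: complex_inner \<Rightarrow>\<^sub>C\<^sub>L 'b :: complex_inner"
  assumes nonzero: "\<exists>x :: 'a. x \<noteq> 0"
  shows "T1 \<parallel> T2 \<longleftrightarrow>
    (\<exists>\<xi> c. (\<forall>n :: nat. norm (\<xi> n) = 1) \<and> cmod c = 1 \<and>
      (\<lambda>n. cinner (T1 *\<^sub>V \<xi> n) (T2 *\<^sub>V \<xi> n)) \<longlonglongrightarrow> c * complex_of_real (norm T1 * norm T2))"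
    (is "_ \<longleftrightarrow> ?limit")
proof
  define a where "a = norm T1"
  define b where "b = norm T2"
  have [simp]: "0 \<le> a" "0 \<le> b" by (simp_all add: a_def b_def)
  assume "T1 \<parallel> T2"
  then obtain c where c: "cmod c = 1" and sum: "norm (T1 + c *\<^sub>C T2) = a + b"
    by (auto simp: parallel_def a_def b_def)
  have "\<exists>x. norm x = 1 \<and> a + b - 1 / Suc n < norm ((T1 + c *\<^sub>C T2) *\<^sub>V x)" for n
    using norm_cblinfun_approx[OF nonzero, of "1 / Suc n" "T1 + c *\<^sub>C T2"] sum by auto
  then obtain \<xi> where unit: "\<And>n. norm (\<xi> n) = 1"
    and large: "\<And>n. a + b - 1 / Suc n < norm ((T1 + c *\<^sub>C T2) *\<^sub>V \<xi> n)"
    by metis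
  let ?s = "\<lambda>n. norm (T1 *\<^sub>V \<xi> n + c *\<^sub>C (T2 *\<^sub>V \<xi> n))"
  have "?s \<longlonglongrightarrow> a + b"
  proof (rule tendsto_sandwich[of "\<lambda>n. a + b - 1 / Suc n" _ _ "\<lambda>_. a + b"])
    show "(\<lambda>n. a + b - 1 / real (Suc n)) \<longlonglongrightarrow> a + b"
      using tendsto_diff[OF tendsto_const LIMSEQ_inverse_real_of_nat, of "a + b"]
      by (simp add: inverse_eq_divide)
    show "\<forall>\<^sub>F n in sequentially. ?s n \<le> a + b"
      using norm_cblinfun_apply[of "T1 + c *\<^sub>C T2" "\<xi> _"] unit sum by simp
  qed (use less_imp_le[OF large] in simp_all)
  define w where "w = (\<lambda>n. cnj c * cinner (T1 *\<^sub>V \<xi> n) (T2 *\<^sub>V \<xi> n))"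
  have close: "(cmod (w n - complex_of_real (a * b)))\<^sup>2 \<le> a * b * ((a + b)\<^sup>2 - (?s n)\<^sup>2)" for n
  proof -
    have n1: "norm (T1 *\<^sub>V \<xi> n) \<le> a" and n2: "norm (T2 *\<^sub>V \<xi> n) \<le> b"
      using norm_cblinfun_apply[of T1 "\<xi> n"] norm_cblinfun_apply[of T2 "\<xi> n"] unit
      by (simp_all add: a_def b_def)
    have "cmod (w n) \<le> norm (T1 *\<^sub>V \<xi> n) * norm (T2 *\<^sub>V \<xi> n)"
      using c by (simp add: w_def norm_mult complex_Cauchy_Schwarz)
    also have "\<dots> \<le> a * b"
      using n1 n2 by (intro mult_mono) auto
    finally have "(cmod (w n - complex_of_real (a * b)))\<^sup>2 \<le> 2 * (a * b) * (a * b - Re (w n))"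
      by (rule cmod_diff_real_squared_le)
    also have "\<dots> = a * b * (2 * (a * b) - 2 * Re (w n))"
      by (simp add: algebra_simps)
    also have "\<dots> \<le> a * b * ((a + b)\<^sup>2 - (?s n)\<^sup>2)"
    proof (rule mult_left_mono)
      have "(?s n)\<^sup>2 = (norm (T1 *\<^sub>V \<xi> n))\<^sup>2 + (norm (T2 *\<^sub>V \<xi> n))\<^sup>2 + 2 * Re (w n)"
        by (simp add: norm_add_squared norm_scaleC c cinner_scaleC_right w_def)
      also have "\<dots> \<le> a\<^sup>2 + b\<^sup>2 + 2 * Re (w n)"
        using n1 n2 by (intro add_mono power_mono) auto
      finally show "2 * (a * b) - 2 * Re (w n) \<le> (a + b)\<^sup>2 - (?s n)\<^sup>2"
        by (simp add: power2_sum)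
    qed simp
    finally show ?thesis .
  qed
  have "(\<lambda>n. a * b * ((a + b)\<^sup>2 - (?s n)\<^sup>2)) \<longlonglongrightarrow> a * b * ((a + b)\<^sup>2 - (a + b)\<^sup>2)"
    by (intro tendsto_intros \<open>?s \<longlonglongrightarrow> a + b\<close>)
  then have "(\<lambda>n. w n - complex_of_real (a * b)) \<longlonglongrightarrow> 0"
    by (intro tendsto_zero_if_norm_squared_le[OF close]) simp
  then have "w \<longlonglongrightarrow> complex_of_real (a * b)"
    by (rule LIM_zero_cancel)
  then have "(\<lambda>n. c * w n) \<longlonglongrightarrow> c * complex_of_real (a * b)"
    by (intro tendsto_intros)
  moreover have "c * w n = cinner (T1 *\<^sub>V \<xi> n) (T2 *\<^sub>V \<xi> n)" for n
    using c by (simp add: w_def complex_norm_square[symmetric] flip: mult.assoc)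
  ultimately show ?limit
    using unit c by (auto simp: a_def b_def intro!: exI[of _ \<xi>] exI[of _ c])
next
  define a where "a = norm T1"
  define b where "b = norm T2"
  have [simp]: "0 \<le> a" "0 \<le> b" by (simp_all add: a_def b_def)
  assume ?limit
  then obtain \<xi> c where unit: "\<And>n. norm (\<xi> n) = 1" and c: "cmod c = 1"
    and lim: "(\<lambda>n. cinner (T1 *\<^sub>V \<xi> n) (T2 *\<^sub>V \<xi> n)) \<longlonglongrightarrow> c * complex_of_real (a * b)"
    by (auto simp: a_def b_def)
  let ?N = "norm (T1 + c *\<^sub>C T2)"
  have upper: "?N \<le> a + b"
    using norm_triangle_ineq[of T1 "c *\<^sub>C T2"] c by (simp add: norm_scaleC a_def b_def)
  have "a + b \<le> ?N"
  proof (cases "a = 0 \<or> b = 0")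
    case True
    then show ?thesis
      using c by (auto simp: a_def b_def norm_scaleC scaleC_zero_right)
  next
    case False
    then have pos: "0 < a" "0 < b" by (auto simp: less_le)
    define w where "w = (\<lambda>n. cnj c * cinner (T1 *\<^sub>V \<xi> n) (T2 *\<^sub>V \<xi> n))"
    have "w \<longlonglongrightarrow> cnj c * (c * complex_of_real (a * b))"
      unfolding w_def by (intro tendsto_intros lim)
    then have w: "w \<longlonglongrightarrow> complex_of_real (a * b)"
      using c by (simp add: complex_norm_square[symmetric] mult.commute[of "cnj c"] flip: mult.assoc)
    have "(\<lambda>n. (cmod (w n) / b)\<^sup>2 + (cmod (w n) / a)\<^sup>2 + 2 * Re (w n))
        \<longlonglongrightarrow> (cmod (complex_of_real (a * b)) / b)\<^sup>2 + (cmod (complex_of_real (a * b)) / a)\<^sup>2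
          + 2 * Re (complex_of_real (a * b))"
      using pos by (intro tendsto_intros w) auto
    moreover have "(cmod (complex_of_real (a * b)) / b)\<^sup>2 + (cmod (complex_of_real (a * b)) / a)\<^sup>2
          + 2 * Re (complex_of_real (a * b)) = (a + b)\<^sup>2"
      using pos by (simp add: norm_mult power2_sum)
    moreover have "(cmod (w n) / b)\<^sup>2 + (cmod (w n) / a)\<^sup>2 + 2 * Re (w n) \<le> ?N\<^sup>2" for n
    proof -
      have n1: "norm (T1 *\<^sub>V \<xi> n) \<le> a" and n2: "norm (T2 *\<^sub>V \<xi> n) \<le> b"
        using norm_cblinfun_apply[of T1 "\<xi> n"] norm_cblinfun_apply[of T2 "\<xi> n"] unit
        by (simp_all add: a_def b_def)
      have w_le: "cmod (w n) \<le> norm (T1 *\<^sub>V \<xi> n) * norm (T2 *\<^sub>V \<xi> n)"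
        using c by (simp add: w_def norm_mult complex_Cauchy_Schwarz)
      have "cmod (w n) / b \<le> norm (T1 *\<^sub>V \<xi> n)"
        using w_le mult_left_mono[OF n2 norm_ge_zero[of "T1 *\<^sub>V \<xi> n"]] pos
        by (simp add: divide_le_eq)
      moreover have "cmod (w n) / a \<le> norm (T2 *\<^sub>V \<xi> n)"
        using w_le mult_right_mono[OF n1 norm_ge_zero[of "T2 *\<^sub>V \<xi> n"]] pos
        by (simp add: divide_le_eq mult.commute)
      ultimately have "(cmod (w n) / b)\<^sup>2 + (cmod (w n) / a)\<^sup>2 + 2 * Re (w n)
          \<le> (norm (T1 *\<^sub>V \<xi> n))\<^sup>2 + (norm (T2 *\<^sub>V \<xi> n))\<^sup>2 + 2 * Re (w n)"
        using pos by (intro add_mono power_mono) auto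
      also have "\<dots> = (norm ((T1 + c *\<^sub>C T2) *\<^sub>V \<xi> n))\<^sup>2"
        by (simp add: norm_add_squared norm_scaleC c cinner_scaleC_right w_def)
      also have "\<dots> \<le> ?N\<^sup>2"
        using norm_cblinfun_apply[of "T1 + c *\<^sub>C T2" "\<xi> n"] unit by (intro power_mono) auto
      finally show ?thesis .
    qed
    ultimately have "(a + b)\<^sup>2 \<le> ?N\<^sup>2"
      by (intro LIMSEQ_le_const2) auto
    then show ?thesis
      by (rule power2_le_imp_le) simp
  qed
  with upper show "T1 \<parallel> T2"
    using c unfolding parallel_def a_def b_def by (intro exI[of _ c]) simp
qed

text \<open>
  The norm of \<open>(T1 + c T2)\<^sup>* (T1 + c T2)\<close> is \<open>(|T1| + |T2|)\<^sup>2\<close>.  Expand the left factor: the part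
  with \<open>T2\<^sup>*\<close> contributes at most \<open>|T2| (|T1| + |T2|)\<close>, so the part with \<open>T1\<^sup>*\<close> must be maximal.
  For the converse a factor \<open>|T1|\<close> is cancelled, and \<open>T1 = 0\<close> is parallel to every operator.
\<close>

lemma parallel_iff_norm_adj_compose:
  fixes T1 T2 :: "'a :: complex_hilbert \<Rightarrow>\<^sub>C\<^sub>L 'b :: complex_hilbert"
  shows "T1 \<parallel> T2 \<longleftrightarrow> (\<exists>c. cmod c = 1 \<and>
    norm (adj T1 o\<^sub>C\<^sub>L (T1 + c *\<^sub>C T2)) = norm T1 * (norm T1 + norm T2))"
    (is "_ \<longleftrightarrow> ?compose")
proof
  assume "T1 \<parallel> T2"
  then obtain c where c: "cmod c = 1" and sum: "norm (T1 + c *\<^sub>C T2) = norm T1 + norm T2"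
    by (auto simp: parallel_def)
  define S where "S = T1 + c *\<^sub>C T2"
  have "adj S o\<^sub>C\<^sub>L S = (adj T1 o\<^sub>C\<^sub>L S) + cnj c *\<^sub>C (adj T2 o\<^sub>C\<^sub>L S)"
  proof (rule cblinfun_eqI, rule cinner_extensionality)
    fix x y
    show "cinner y ((adj S o\<^sub>C\<^sub>L S) *\<^sub>V x)
        = cinner y (((adj T1 o\<^sub>C\<^sub>L S) + cnj c *\<^sub>C (adj T2 o\<^sub>C\<^sub>L S)) *\<^sub>V x)"
      by (simp add: cinner_add_right cinner_scaleC_right flip: cinner_adj)
        (simp add: S_def cinner_add_left cinner_scaleC_left)
  qed
  then have "norm (adj S o\<^sub>C\<^sub>L S) \<le> norm (adj T1 o\<^sub>C\<^sub>L S) + norm (adj T2 o\<^sub>C\<^sub>L S)"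
    using norm_triangle_ineq[of "adj T1 o\<^sub>C\<^sub>L S" "cnj c *\<^sub>C (adj T2 o\<^sub>C\<^sub>L S)"] c
    by (simp add: norm_scaleC)
  moreover have "(norm T1 + norm T2)\<^sup>2 \<le> norm (adj S o\<^sub>C\<^sub>L S)"
    using norm_adj_compose_self[of S] sum by (simp add: S_def)
  moreover have "norm (adj T1 o\<^sub>C\<^sub>L S) \<le> norm T1 * (norm T1 + norm T2)"
    and "norm (adj T2 o\<^sub>C\<^sub>L S) \<le> norm T2 * (norm T1 + norm T2)"
    using norm_adj_compose_le[of T1 S] norm_adj_compose_le[of T2 S] sum by (simp_all add: S_def)
  ultimately have "norm (adj T1 o\<^sub>C\<^sub>L S) = norm T1 * (norm T1 + norm T2)"
    by (simp add: power2_eq_square algebra_simps)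
  then show ?compose
    using c unfolding S_def by blast
next
  assume ?compose
  then obtain c where c: "cmod c = 1"
    and eq: "norm (adj T1 o\<^sub>C\<^sub>L (T1 + c *\<^sub>C T2)) = norm T1 * (norm T1 + norm T2)"
    by blast
  have "norm (T1 + c *\<^sub>C T2) = norm T1 + norm T2"
  proof (cases "T1 = 0")
    case False
    then have "norm T1 + norm T2 \<le> norm (T1 + c *\<^sub>C T2)"
      using norm_adj_compose_le[of T1 "T1 + c *\<^sub>C T2"] by (simp add: eq)
    then show ?thesis
      using norm_triangle_ineq[of T1 "c *\<^sub>C T2"] c by (simp add: norm_scaleC)
  qed (simp add: norm_scaleC c)
  then show "T1 \<parallel> T2"
    using c by (auto simp: parallel_def)
qed

text \<open>
  The norm of \<open>T1\<^sup>* T1 + c T1\<^sup>* T2\<close> is at most the sum of the norms of the two terms, which is at most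
  \<open>|T1|\<^sup>2 + |T1| |T2|\<close>; the first condition asks for equality overall, the second for
  equality in each of the two steps.
\<close>

lemma norm_adj_compose_iff_parallel:
  fixes T1 T2 :: "'a :: complex_hilbert \<Rightarrow>\<^sub>C\<^sub>L 'b :: complex_hilbert"
  shows "(\<exists>c. cmod c = 1 \<and>
      norm (adj T1 o\<^sub>C\<^sub>L (T1 + c *\<^sub>C T2)) = norm T1 * (norm T1 + norm T2)) \<longleftrightarrow>
    (adj T1 o\<^sub>C\<^sub>L T1) \<parallel> (adj T1 o\<^sub>C\<^sub>L T2) \<and> norm (adj T1 o\<^sub>C\<^sub>L T2) = norm T1 * norm T2"
proof -
  have "norm (adj T1 o\<^sub>C\<^sub>L T1) = norm T1 * norm T1"
    using norm_adj_compose_self[of T1] norm_adj_compose_le[of T1 T1] by (simp add: power2_eq_square)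
  moreover have "norm (adj T1 o\<^sub>C\<^sub>L (T1 + c *\<^sub>C T2))
      \<le> norm (adj T1 o\<^sub>C\<^sub>L T1) + norm (adj T1 o\<^sub>C\<^sub>L T2)" if "cmod c = 1" for c
    using norm_triangle_ineq[of "adj T1 o\<^sub>C\<^sub>L T1" "c *\<^sub>C (adj T1 o\<^sub>C\<^sub>L T2)"] that
    by (simp add: cblinfun_compose_add_scaleC_right norm_scaleC)
  ultimately show ?thesis
    using norm_adj_compose_le[of T1 T2]
    unfolding parallel_def cblinfun_compose_add_scaleC_right[symmetric]
    by (fastforce simp: distrib_left)
qed

theorem theorem3p3:
  fixes T1 T2 :: "'h :: complex_hilbert \<Rightarrow>\<^sub>C\<^sub>L 'h"
  assumes "\<exists>x :: 'h. x \<noteq> 0"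
  shows "(T1 \<parallel> T2 \<longleftrightarrow>
            (\<exists>(\<xi> :: nat \<Rightarrow> 'h) (c :: complex). (\<forall>n. norm (\<xi> n) = 1) \<and> cmod c = 1 \<and>
               (\<lambda>n. cinner (T1 *\<^sub>V \<xi> n) (T2 *\<^sub>V \<xi> n))
                 \<longlonglongrightarrow> c * complex_of_real (norm T1 * norm T2)))
       \<and> (T1 \<parallel> T2 \<longleftrightarrow>
            spectral_radius (adj T2 o\<^sub>C\<^sub>L T1) = norm (adj T2 o\<^sub>C\<^sub>L T1) \<and>
            norm (adj T2 o\<^sub>C\<^sub>L T1) = norm T1 * norm T2)
       \<and> (T1 \<parallel> T2 \<longleftrightarrow>
            (adj T1 o\<^sub>C\<^sub>L T1) \<parallel> (adj T1 o\<^sub>C\<^sub>L T2) \<and>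
            norm (adj T1 o\<^sub>C\<^sub>L T2) = norm T1 * norm T2)
       \<and> (T1 \<parallel> T2 \<longleftrightarrow>
            (\<exists>c :: complex. cmod c = 1 \<and>
               norm (adj T1 o\<^sub>C\<^sub>L (T1 + c *\<^sub>C T2)) = norm T1 * (norm T1 + norm T2)))"
proof (intro conjI)
  show "T1 \<parallel> T2 \<longleftrightarrow>
      spectral_radius (adj T2 o\<^sub>C\<^sub>L T1) = norm (adj T2 o\<^sub>C\<^sub>L T1) \<and>
      norm (adj T2 o\<^sub>C\<^sub>L T1) = norm T1 * norm T2"
    unfolding parallel_iff_cinner_limit[OF assms]
    using numerical_range_limit_iff_spectral_radius[OF assms, of "adj T2 o\<^sub>C\<^sub>L T1" "norm T1 * norm T2"]
      norm_adj_compose_le[of T2 T1]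
    by (simp add: cinner_adj_left mult.commute)
  show "T1 \<parallel> T2 \<longleftrightarrow>
      (adj T1 o\<^sub>C\<^sub>L T1) \<parallel> (adj T1 o\<^sub>C\<^sub>L T2) \<and>
      norm (adj T1 o\<^sub>C\<^sub>L T2) = norm T1 * norm T2"
    by (rule trans[OF parallel_iff_norm_adj_compose norm_adj_compose_iff_parallel])
qed (rule parallel_iff_cinner_limit[OF assms] parallel_iff_norm_adj_compose)+

end
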